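(* Fix a mode theory $\mathcal{M}$ (a strict 2-category) and consider the multimodal $\lambda$-calculus and the substitution operation $N[M/x]_\Gamma$ described in the context. For every modality $\mu:n\to m$, context $\Gamma$ ctx $@\,m$, pre-context $\Delta$, mode $b$, terms $M,N$ and types $A,B$: if $\Gamma.\mathsf{lock}_\mu\vdash M : A\ @\,n$ and $\Gamma, x:(\mu\mid A),\Delta\vdash N : B\ @\,b$ are derivable, then $\Gamma,\Delta\vdash N[M/x]_\Gamma : B\ @\,b$ is derivable.
   Context: A mode theory is a strict 2-category $\mathcal{M}$: objects are modes; 1-cells $\mu:n\to m$ are modalities, with composition $\mu\circ\nu$ and identities $1_m$; 2-cells $\alpha:\mu\Rightarrow\nu$ between parallel modalities are transformations, with vertical composition $\beta\circ\alpha$, identities $1_\mu$ and horizontal composition $\alpha*\beta:\mu\circ\theta\Rightarrow\nu\circ\xi$ for $\alpha:\mu\Rightarrow\nu$, $\beta:\theta\Rightarrow\xi$, obeying the strict 2-category laws. Types: pre-types $A,B ::= p_i \mid \bot \mid \top \mid A+B \mid A\times B \mid (\mu\mid A)\to B \mid \langle\mu\mid A\rangle$; "$A$ type $@\,m$" is generated by: $p_i,\top,\bot$ are types at every mode; $A\times B$, $A+B$ type $@\,m$ if $A,B$ type $@\,m$; $(\mu\mid A)\to B$ type $@\,m$ if $\mu:n\to m$, $A$ type $@\,n$, $B$ type $@\,m$; $\langle\mu\mid A\rangle$ type $@\,m$ if $A$ type $@\,n$ and $\mu:n\to m$. Contexts: pre-contexts $\Gamma ::= \cdot \mid \Gamma,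 x:(\mu\mid A)\mid \Gamma.\mathsf{lock}_\mu$; "$\Gamma$ ctx $@\,m$" is generated by: $\cdot$ ctx $@\,m$; $\Gamma, x:(\mu\mid A)$ ctx $@\,m$ if $\Gamma$ ctx $@\,m$, $A$ type $@\,n$, $\mu:n\to m$, $x$ fresh; $\Gamma.\mathsf{lock}_\mu$ ctx $@\,n$ if $\Gamma$ ctx $@\,m$ and $\mu:n\to m$. Contexts are identified modulo $\Gamma.\mathsf{lock}_{1_m}=\Gamma$ and $\Gamma.\mathsf{lock}_\mu.\mathsf{lock}_\nu=\Gamma.\mathsf{lock}_{\mu\circ\nu}$. $\Gamma,\Delta$ is concatenation. Define $|\cdot|=1$, $|\Gamma,x:(\mu\mid A)|=|\Gamma|$, $|\Gamma.\mathsf{lock}_\mu|=|\Gamma|\circ\mu$. Typing judgement $\Gamma\vdash M:A\ @\,m$ generated by (premises at mode $m$ unless indicated; bound variables up to capture-avoiding renaming): (var) if $\mu:n\to m$ and $\alpha:\mu\Rightarrow|\Delta|$ then $\Gamma, x:(\mu\mid A),\Delta\vdash x_\alpha : A\ @\,n$; (pair) from $M:A$, $N:B$ infer $\langle M,N\rangle : A\times B$; (proj) from $P:A_1\times A_2$ infer $\pi_i(P):A_i$; (lam) from $\Gamma,x:(\mu\mid A)\vdash M:B$ infer $\Gamma\vdash\lambda x.M : (\mu\mid A)\to B$; (app) if $\mu:n\to m$, from $\Gamma\vdash M:(\mu\mid A)\to B\ @\,m$ and $\Gamma.\mathsf{lock}_\mu\vdash N:A\ @\,n$ infer $\Gamma\vdash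 M\,@_\mu N : B\ @\,m$; (inj) from $M:A_i$ infer $\mathsf{in}_i(M):A_1+A_2$; (case) from $\Gamma\vdash M:A+B$, $\Gamma,x:(1\mid A)\vdash P:C$, $\Gamma,y:(1\mid B)\vdash Q:C$ infer $\Gamma\vdash\mathsf{case}\ M\ \mathsf{of}\ (x.P;\ y.Q):C$; (mod) if $\mu:n\to m$, from $\Gamma.\mathsf{lock}_\mu\vdash M:A\ @\,n$ infer $\Gamma\vdash\mathsf{mod}_\mu(M):\langle\mu\mid A\rangle\ @\,m$; (let) if $\nu:o\to n$, $\mu:n\to m$, from $\Gamma.\mathsf{lock}_\mu\vdash M:\langle\nu\mid A\rangle\ @\,n$ and $\Gamma,x:(\mu\circ\nu\mid A)\vdash N:B\ @\,m$ infer $\Gamma\vdash\mathsf{let}_\mu\ \mathsf{mod}_\nu(x)=M\ \mathsf{in}\ N : B\ @\,m$. Lock-weakening operation. For a 2-cell $\alpha$ and disjoint pre-contexts $\Gamma,\Delta$, the partial operation $M\{\Gamma,\alpha,\Delta\}$ is defined by recursion on $M$: if $\Gamma=\Gamma_0,x:(\rho\mid A),\Gamma'$ then $x_{\alpha'}\{\Gamma,\alpha,\Delta\}=x_{(1_{|\Gamma'|}*\alpha*1_{|\Delta|})\circ\alpha'}$; if $x$ is declared in $\Delta$ then $x_{\alpha'}\{\Gamma,\alpha,\Delta\}=x_{\alpha'}$; $(\lambda x.M)\{\Gamma,\alpha,\Delta\}=\lambda x.M\{\Gamma,\alpha,(\Delta,x:(\xi\mid A))\}$ ($x$ bound with tag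 $\xi$, type $A$); $(M\,@_\xi N)\{\Gamma,\alpha,\Delta\}=M\{\Gamma,\alpha,\Delta\}\,@_\xi\,N\{\Gamma,\alpha,\Delta.\mathsf{lock}_\xi\}$; $\mathsf{mod}_\xi(M)\{\Gamma,\alpha,\Delta\}=\mathsf{mod}_\xi(M\{\Gamma,\alpha,\Delta.\mathsf{lock}_\xi\})$; pairs, projections and injections: componentwise with the same parameters; $(\mathsf{let}_\rho\ \mathsf{mod}_\xi(x)=M\ \mathsf{in}\ N)\{\Gamma,\alpha,\Delta\}=\mathsf{let}_\rho\ \mathsf{mod}_\xi(x)=M\{\Gamma,\alpha,\Delta.\mathsf{lock}_\rho\}\ \mathsf{in}\ N\{\Gamma,\alpha,(\Delta,x:(\rho\circ\xi\mid A))\}$; $(\mathsf{case}\ M\ \mathsf{of}\ (x.P;y.Q))\{\Gamma,\alpha,\Delta\}=\mathsf{case}\ M\{\Gamma,\alpha,\Delta\}\ \mathsf{of}\ (x.P\{\Gamma,\alpha,(\Delta,x:(1\mid A))\};\ y.Q\{\Gamma,\alpha,(\Delta,y:(1\mid B))\})$. Substitution. With $\Gamma$ a fixed global parameter, $N[M/x]_\Gamma$ is defined by recursion on $N$: $x_\alpha[M/x]_\Gamma = M\{\Gamma,\alpha,\cdot\}$; $y_\beta[M/x]_\Gamma = y_\beta$ for $y\neq x$; $\mathsf{mod}_\xi(N)[M/x]_\Gamma=\mathsf{mod}_\xi(N[M/x]_\Gamma)$; $(\mathsf{let}_\rho\ \mathsf{mod}_\xi(y)=N_0\ \mathsf{in}\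 N_1)[M/x]_\Gamma=\mathsf{let}_\rho\ \mathsf{mod}_\xi(y)=N_0[M/x]_\Gamma\ \mathsf{in}\ N_1[M/x]_\Gamma$; and all remaining term formers (pairs, projections, $\lambda$, application, injections, case) are handled by applying the substitution to the immediate subterms, with the usual capture-avoidance for bound variables. *)

theory Defs
  imports Main "HOL-Library.Monad_Syntax"
begin

section \<open>Mode theories\<close>

record ('o, 'm, 't) two_cat =
  Ob :: "'o set"
  Cell1 :: "'m set"
  src :: "'m \<Rightarrow> 'o"
  tgt :: "'m \<Rightarrow> 'o"
  id1 :: "'o \<Rightarrow> 'm"
  comp1 :: "'m \<Rightarrow> 'm \<Rightarrow> 'm"
  Cell2 :: "'t set"
  dom2 :: "'t \<Rightarrow> 'm"
  cod2 :: "'t \<Rightarrow> 'm"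
  id2 :: "'m \<Rightarrow> 't"
  vcomp :: "'t \<Rightarrow> 't \<Rightarrow> 't"
  hcomp :: "'t \<Rightarrow> 't \<Rightarrow> 't"

text \<open>\<open>modality \<M> \<mu> n m\<close> is \<open>\<mu> : n \<rightarrow> m\<close>, and \<open>transf \<M> \<alpha> \<mu> \<nu>\<close> is \<open>\<alpha> : \<mu> \<Rightarrow> \<nu>\<close>.
  All three compositions are written in applicative order.\<close>

definition modality :: "('o, 'm, 't) two_cat \<Rightarrow> 'm \<Rightarrow> 'o \<Rightarrow> 'o \<Rightarrow> bool" where
  "modality \<M> \<mu> n m \<longleftrightarrow> \<mu> \<in> Cell1 \<M> \<and> src \<M> \<mu> = n \<and> tgt \<M> \<mu> = m"

definition transf :: "('o, 'm, 't) two_cat \<Rightarrow> 't \<Rightarrow> 'm \<Rightarrow> 'm \<Rightarrow> bool" where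
  "transf \<M> \<alpha> \<mu> \<nu> \<longleftrightarrow> \<alpha> \<in> Cell2 \<M> \<and> dom2 \<M> \<alpha> = \<mu> \<and> cod2 \<M> \<alpha> = \<nu>"

locale mode_theory =
  fixes \<M> :: "('o, 'm, 't) two_cat"
  assumes modality_Ob: "modality \<M> \<mu> n m \<Longrightarrow> n \<in> Ob \<M> \<and> m \<in> Ob \<M>"
    and id1_modality: "m \<in> Ob \<M> \<Longrightarrow> modality \<M> (id1 \<M> m) m m"
    and comp1_modality:
      "\<lbrakk>modality \<M> \<mu> n m; modality \<M> \<nu> k n\<rbrakk> \<Longrightarrow> modality \<M> (comp1 \<M> \<mu> \<nu>) k m"
    and comp1_id_left: "modality \<M> \<mu> n m \<Longrightarrow> comp1 \<M> (id1 \<M> m) \<mu> = \<mu>"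
    and comp1_id_right: "modality \<M> \<mu> n m \<Longrightarrow> comp1 \<M> \<mu> (id1 \<M> n) = \<mu>"
    and comp1_assoc:
      "\<lbrakk>modality \<M> \<mu> n m; modality \<M> \<nu> k n; modality \<M> \<xi> l k\<rbrakk>
        \<Longrightarrow> comp1 \<M> (comp1 \<M> \<mu> \<nu>) \<xi> = comp1 \<M> \<mu> (comp1 \<M> \<nu> \<xi>)"
    and transf_parallel:
      "transf \<M> \<alpha> \<mu> \<nu> \<Longrightarrow> \<exists>n m. modality \<M> \<mu> n m \<and> modality \<M> \<nu> n m"
    and id2_transf: "modality \<M> \<mu> n m \<Longrightarrow> transf \<M> (id2 \<M> \<mu>) \<mu> \<mu>"
    and vcomp_transf:
      "\<lbrakk>transf \<M> \<beta> \<nu> \<xi>; transf \<M> \<alpha> \<mu> \<nu>\<rbrakk> \<Longrightarrow> transf \<M> (vcomp \<M> \<beta> \<alpha>) \<mu> \<xi>"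
    and vcomp_id_left: "transf \<M> \<alpha> \<mu> \<nu> \<Longrightarrow> vcomp \<M> (id2 \<M> \<nu>) \<alpha> = \<alpha>"
    and vcomp_id_right: "transf \<M> \<alpha> \<mu> \<nu> \<Longrightarrow> vcomp \<M> \<alpha> (id2 \<M> \<mu>) = \<alpha>"
    and vcomp_assoc:
      "\<lbrakk>transf \<M> \<gamma> \<xi> \<theta>; transf \<M> \<beta> \<nu> \<xi>; transf \<M> \<alpha> \<mu> \<nu>\<rbrakk>
        \<Longrightarrow> vcomp \<M> (vcomp \<M> \<gamma> \<beta>) \<alpha> = vcomp \<M> \<gamma> (vcomp \<M> \<beta> \<alpha>)"
    and hcomp_transf:
      "\<lbrakk>transf \<M> \<alpha> \<mu> \<nu>; transf \<M> \<beta> \<theta> \<xi>; modality \<M> \<mu> n m; modality \<M> \<theta> k n\<rbrakk>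
        \<Longrightarrow> transf \<M> (hcomp \<M> \<alpha> \<beta>) (comp1 \<M> \<mu> \<theta>) (comp1 \<M> \<nu> \<xi>)"
    and hcomp_id_left:
      "\<lbrakk>transf \<M> \<alpha> \<mu> \<nu>; modality \<M> \<mu> n m\<rbrakk> \<Longrightarrow> hcomp \<M> (id2 \<M> (id1 \<M> m)) \<alpha> = \<alpha>"
    and hcomp_id_right:
      "\<lbrakk>transf \<M> \<alpha> \<mu> \<nu>; modality \<M> \<mu> n m\<rbrakk> \<Longrightarrow> hcomp \<M> \<alpha> (id2 \<M> (id1 \<M> n)) = \<alpha>"
    and hcomp_assoc:
      "\<lbrakk>transf \<M> \<alpha> \<mu> \<mu>'; transf \<M> \<beta> \<nu> \<nu>'; transf \<M> \<gamma> \<xi> \<xi>';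
        modality \<M> \<mu> n m; modality \<M> \<nu> k n; modality \<M> \<xi> l k\<rbrakk>
        \<Longrightarrow> hcomp \<M> (hcomp \<M> \<alpha> \<beta>) \<gamma> = hcomp \<M> \<alpha> (hcomp \<M> \<beta> \<gamma>)"
    and hcomp_id2:
      "\<lbrakk>modality \<M> \<mu> n m; modality \<M> \<nu> k n\<rbrakk>
        \<Longrightarrow> hcomp \<M> (id2 \<M> \<mu>) (id2 \<M> \<nu>) = id2 \<M> (comp1 \<M> \<mu> \<nu>)"
    and interchange:
      "\<lbrakk>transf \<M> \<beta> \<mu>' \<mu>''; transf \<M> \<alpha> \<mu> \<mu>'; transf \<M> \<delta> \<nu>' \<nu>''; transf \<M> \<gamma> \<nu> \<nu>';
        modality \<M> \<mu> n m; modality \<M> \<nu> k n\<rbrakk>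
        \<Longrightarrow> hcomp \<M> (vcomp \<M> \<beta> \<alpha>) (vcomp \<M> \<delta> \<gamma>) = vcomp \<M> (hcomp \<M> \<beta> \<delta>) (hcomp \<M> \<alpha> \<gamma>)"

section \<open>Types and contexts\<close>

datatype 'm ty =
    Atom nat
  | Bot
  | Top
  | Plus "'m ty" "'m ty"
  | Times "'m ty" "'m ty"
  | Arr 'm "'m ty" "'m ty"
  | Modal 'm "'m ty"

inductive is_ty :: "('o, 'm, 't) two_cat \<Rightarrow> 'm ty \<Rightarrow> 'o \<Rightarrow> bool" for \<M> where
  ty_Atom: "m \<in> Ob \<M> \<Longrightarrow> is_ty \<M> (Atom i) m"
| ty_Bot: "m \<in> Ob \<M> \<Longrightarrow> is_ty \<M> Bot m"
| ty_Top: "m \<in> Ob \<M> \<Longrightarrow> is_ty \<M> Top m"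
| ty_Plus: "\<lbrakk>is_ty \<M> A m; is_ty \<M> B m\<rbrakk> \<Longrightarrow> is_ty \<M> (Plus A B) m"
| ty_Times: "\<lbrakk>is_ty \<M> A m; is_ty \<M> B m\<rbrakk> \<Longrightarrow> is_ty \<M> (Times A B) m"
| ty_Arr: "\<lbrakk>modality \<M> \<mu> n m; is_ty \<M> A n; is_ty \<M> B m\<rbrakk> \<Longrightarrow> is_ty \<M> (Arr \<mu> A B) m"
| ty_Modal: "\<lbrakk>is_ty \<M> A n; modality \<M> \<mu> n m\<rbrakk> \<Longrightarrow> is_ty \<M> (Modal \<mu> A) m"

type_synonym vname = nat

datatype 'm pctx =
    Emp
  | Ext "'m pctx" vname 'm "'m ty"
  | Lock "'m pctx" 'm

primrec cat :: "'m pctx \<Rightarrow> 'm pctx \<Rightarrow> 'm pctx" where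
  "cat \<Gamma> Emp = \<Gamma>"
| "cat \<Gamma> (Ext \<Delta> x \<mu> A) = Ext (cat \<Gamma> \<Delta>) x \<mu> A"
| "cat \<Gamma> (Lock \<Delta> \<mu>) = Lock (cat \<Gamma> \<Delta>) \<mu>"

primrec vars :: "'m pctx \<Rightarrow> vname set" where
  "vars Emp = {}"
| "vars (Ext \<Gamma> x \<mu> A) = insert x (vars \<Gamma>)"
| "vars (Lock \<Gamma> \<mu>) = vars \<Gamma>"

text \<open>\<open>locks \<M> m \<Delta>\<close> is \<open>|\<Delta>|\<close> for a pre-context \<open>\<Delta>\<close> that extends a context at mode \<open>m\<close>; the mode
  resolves which identity \<open>|\<cdot>| = 1\<close> refers to.\<close>

primrec locks :: "('o, 'm, 't) two_cat \<Rightarrow> 'o \<Rightarrow> 'm pctx \<Rightarrow> 'm" where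
  "locks \<M> m Emp = id1 \<M> m"
| "locks \<M> m (Ext \<Delta> x \<mu> A) = locks \<M> m \<Delta>"
| "locks \<M> m (Lock \<Delta> \<mu>) = comp1 \<M> (locks \<M> m \<Delta>) \<mu>"

inductive is_ctx :: "('o, 'm, 't) two_cat \<Rightarrow> 'm pctx \<Rightarrow> 'o \<Rightarrow> bool" for \<M> where
  ctx_Emp: "m \<in> Ob \<M> \<Longrightarrow> is_ctx \<M> Emp m"
| ctx_Ext: "\<lbrakk>is_ctx \<M> \<Gamma> m; is_ty \<M> A n; modality \<M> \<mu> n m; x \<notin> vars \<Gamma>\<rbrakk>
    \<Longrightarrow> is_ctx \<M> (Ext \<Gamma> x \<mu> A) m"
| ctx_Lock: "\<lbrakk>is_ctx \<M> \<Gamma> m; modality \<M> \<mu> n m\<rbrakk> \<Longrightarrow> is_ctx \<M> (Lock \<Gamma> \<mu>) n"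

text \<open>The identification of contexts, as a congruence on well-formed contexts at a given mode. The
  mode index is essential: the empty context lives at every mode, so an unindexed congruence would
  identify the empty context locked by \<open>1\<^sub>m\<close> (at mode \<open>m\<close>) with the one locked by \<open>1\<^sub>n\<close>
  (at mode \<open>n\<close>).\<close>

inductive ctx_eq :: "('o, 'm, 't) two_cat \<Rightarrow> 'o \<Rightarrow> 'm pctx \<Rightarrow> 'm pctx \<Rightarrow> bool" for \<M> where
  eq_refl: "is_ctx \<M> \<Gamma> m \<Longrightarrow> ctx_eq \<M> m \<Gamma> \<Gamma>"
| eq_sym: "ctx_eq \<M> m \<Gamma> \<Gamma>' \<Longrightarrow> ctx_eq \<M> m \<Gamma>' \<Gamma>"
| eq_trans: "\<lbrakk>ctx_eq \<M> m \<Gamma> \<Gamma>'; ctx_eq \<M> m \<Gamma>' \<Gamma>''\<rbrakk> \<Longrightarrow> ctx_eq \<M> m \<Gamma> \<Gamma>''"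
| eq_Ext: "\<lbrakk>ctx_eq \<M> m \<Gamma> \<Gamma>'; is_ctx \<M> (Ext \<Gamma> x \<mu> A) m; is_ctx \<M> (Ext \<Gamma>' x \<mu> A) m\<rbrakk>
    \<Longrightarrow> ctx_eq \<M> m (Ext \<Gamma> x \<mu> A) (Ext \<Gamma>' x \<mu> A)"
| eq_Lock: "\<lbrakk>ctx_eq \<M> m \<Gamma> \<Gamma>'; modality \<M> \<mu> n m\<rbrakk> \<Longrightarrow> ctx_eq \<M> n (Lock \<Gamma> \<mu>) (Lock \<Gamma>' \<mu>)"
| eq_Lock_id: "is_ctx \<M> \<Gamma> m \<Longrightarrow> ctx_eq \<M> m (Lock \<Gamma> (id1 \<M> m)) \<Gamma>"
| eq_Lock_comp: "\<lbrakk>is_ctx \<M> \<Gamma> m; modality \<M> \<mu> n m; modality \<M> \<nu> k n\<rbrakk>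
    \<Longrightarrow> ctx_eq \<M> k (Lock (Lock \<Gamma> \<mu>) \<nu>) (Lock \<Gamma> (comp1 \<M> \<mu> \<nu>))"

section \<open>Terms\<close>

text \<open>Terms up to renaming of bound variables are represented in locally nameless style: free
  variables are names, bound variables are de Bruijn indices, and both carry a 2-cell. The second and
  third argument of \<open>Case\<close> and the last argument of \<open>Let\<close> are under one binder. The named binders
  \<open>lam\<close>, \<open>case_of\<close> and \<open>let_mod\<close> below abstract a free name; the typing rules are stated with them.\<close>

datatype ('m, 't) trm =
    FVar vname 't
  | BVar nat 't
  | Tuple "('m, 't) trm" "('m, 't) trm"
  | Proj1 "('m, 't) trm"
  | Proj2 "('m, 't) trm"
  | Lam "('m, 't) trm"
  | App 'm "('m, 't) trm" "('m, 't) trm"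
  | In1 "('m, 't) trm"
  | In2 "('m, 't) trm"
  | Case "('m, 't) trm" "('m, 't) trm" "('m, 't) trm"
  | Mod 'm "('m, 't) trm"
  | Let 'm 'm "('m, 't) trm" "('m, 't) trm"

primrec bind_var :: "nat \<Rightarrow> vname \<Rightarrow> ('m, 't) trm \<Rightarrow> ('m, 't) trm" where
  "bind_var k x (FVar y \<alpha>) = (if y = x then BVar k \<alpha> else FVar y \<alpha>)"
| "bind_var k x (BVar i \<alpha>) = BVar i \<alpha>"
| "bind_var k x (Tuple M N) = Tuple (bind_var k x M) (bind_var k x N)"
| "bind_var k x (Proj1 M) = Proj1 (bind_var k x M)"
| "bind_var k x (Proj2 M) = Proj2 (bind_var k x M)"
| "bind_var k x (Lam M) = Lam (bind_var (Suc k) x M)"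
| "bind_var k x (App \<mu> M N) = App \<mu> (bind_var k x M) (bind_var k x N)"
| "bind_var k x (In1 M) = In1 (bind_var k x M)"
| "bind_var k x (In2 M) = In2 (bind_var k x M)"
| "bind_var k x (Case M P Q) = Case (bind_var k x M) (bind_var (Suc k) x P) (bind_var (Suc k) x Q)"
| "bind_var k x (Mod \<mu> M) = Mod \<mu> (bind_var k x M)"
| "bind_var k x (Let \<rho> \<xi> M N) = Let \<rho> \<xi> (bind_var k x M) (bind_var (Suc k) x N)"

primrec fv :: "('m, 't) trm \<Rightarrow> vname set" where
  "fv (FVar y \<alpha>) = {y}"
| "fv (BVar i \<alpha>) = {}"
| "fv (Tuple M N) = fv M \<union> fv N"
| "fv (Proj1 M) = fv M"
| "fv (Proj2 M) = fv M"
| "fv (Lam M) = fv M"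
| "fv (App \<mu> M N) = fv M \<union> fv N"
| "fv (In1 M) = fv M"
| "fv (In2 M) = fv M"
| "fv (Case M P Q) = fv M \<union> fv P \<union> fv Q"
| "fv (Mod \<mu> M) = fv M"
| "fv (Let \<rho> \<xi> M N) = fv M \<union> fv N"

definition lam :: "vname \<Rightarrow> ('m, 't) trm \<Rightarrow> ('m, 't) trm" where
  "lam x M = Lam (bind_var 0 x M)"

definition case_of ::
  "('m, 't) trm \<Rightarrow> vname \<Rightarrow> ('m, 't) trm \<Rightarrow> vname \<Rightarrow> ('m, 't) trm \<Rightarrow> ('m, 't) trm" where
  "case_of M x P y Q = Case M (bind_var 0 x P) (bind_var 0 y Q)"

definition let_mod ::
  "'m \<Rightarrow> 'm \<Rightarrow> vname \<Rightarrow> ('m, 't) trm \<Rightarrow> ('m, 't) trm \<Rightarrow> ('m, 't) trm" where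
  "let_mod \<rho> \<xi> x M N = Let \<rho> \<xi> M (bind_var 0 x N)"

section \<open>Typing\<close>

text \<open>The judgement is only meant for \<open>\<Gamma>\<close> a context and \<open>A\<close> a type at mode \<open>m\<close>; the
  well-formedness premises of \<open>t_var\<close>, \<open>t_in1\<close> and \<open>t_in2\<close> enforce this for all derivable
  judgements. The rule \<open>t_conv\<close> expresses that contexts are taken modulo \<open>ctx_eq\<close>.\<close>

inductive typing ::
  "('o, 'm, 't) two_cat \<Rightarrow> 'm pctx \<Rightarrow> ('m, 't) trm \<Rightarrow> 'm ty \<Rightarrow> 'o \<Rightarrow> bool" for \<M> where
  t_var: "\<lbrakk>is_ctx \<M> (cat (Ext \<Gamma> x \<mu> A) \<Delta>) n; modality \<M> \<mu> n m; transf \<M> \<alpha> \<mu> (locks \<M> m \<Delta>)\<rbrakk>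
    \<Longrightarrow> typing \<M> (cat (Ext \<Gamma> x \<mu> A) \<Delta>) (FVar x \<alpha>) A n"
| t_pair: "\<lbrakk>typing \<M> \<Gamma> M A m; typing \<M> \<Gamma> N B m\<rbrakk> \<Longrightarrow> typing \<M> \<Gamma> (Tuple M N) (Times A B) m"
| t_proj1: "typing \<M> \<Gamma> P (Times A B) m \<Longrightarrow> typing \<M> \<Gamma> (Proj1 P) A m"
| t_proj2: "typing \<M> \<Gamma> P (Times A B) m \<Longrightarrow> typing \<M> \<Gamma> (Proj2 P) B m"
| t_lam: "typing \<M> (Ext \<Gamma> x \<mu> A) M B m \<Longrightarrow> typing \<M> \<Gamma> (lam x M) (Arr \<mu> A B) m"
| t_app: "\<lbrakk>modality \<M> \<mu> n m; typing \<M> \<Gamma> M (Arr \<mu> A B) m; typing \<M> (Lock \<Gamma> \<mu>) N A n\<rbrakk>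
    \<Longrightarrow> typing \<M> \<Gamma> (App \<mu> M N) B m"
| t_in1: "\<lbrakk>typing \<M> \<Gamma> M A m; is_ty \<M> B m\<rbrakk> \<Longrightarrow> typing \<M> \<Gamma> (In1 M) (Plus A B) m"
| t_in2: "\<lbrakk>typing \<M> \<Gamma> M B m; is_ty \<M> A m\<rbrakk> \<Longrightarrow> typing \<M> \<Gamma> (In2 M) (Plus A B) m"
| t_case: "\<lbrakk>typing \<M> \<Gamma> M (Plus A B) m; typing \<M> (Ext \<Gamma> x (id1 \<M> m) A) P C m;
      typing \<M> (Ext \<Gamma> y (id1 \<M> m) B) Q C m\<rbrakk>
    \<Longrightarrow> typing \<M> \<Gamma> (case_of M x P y Q) C m"
| t_mod: "\<lbrakk>modality \<M> \<mu> n m; typing \<M> (Lock \<Gamma> \<mu>) M A n\<rbrakk>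
    \<Longrightarrow> typing \<M> \<Gamma> (Mod \<mu> M) (Modal \<mu> A) m"
| t_let: "\<lbrakk>modality \<M> \<nu> k n; modality \<M> \<mu> n m; typing \<M> (Lock \<Gamma> \<mu>) M (Modal \<nu> A) n;
      typing \<M> (Ext \<Gamma> x (comp1 \<M> \<mu> \<nu>) A) N B m\<rbrakk>
    \<Longrightarrow> typing \<M> \<Gamma> (let_mod \<mu> \<nu> x M N) B m"
| t_conv: "\<lbrakk>typing \<M> \<Gamma> M A m; ctx_eq \<M> m \<Gamma> \<Gamma>'\<rbrakk> \<Longrightarrow> typing \<M> \<Gamma>' M A m"

section \<open>Lock-weakening\<close>

text \<open>\<open>locate x \<Gamma> = Some (\<rho>, \<Gamma>')\<close> iff \<open>\<Gamma>\<close> is some \<open>\<Gamma>\<^sub>0, x:(\<rho>|A), \<Gamma>'\<close> with \<open>x\<close> not declared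
  in \<open>\<Gamma>'\<close>.\<close>

primrec locate :: "vname \<Rightarrow> 'm pctx \<Rightarrow> ('m \<times> 'm pctx) option" where
  "locate x Emp = None"
| "locate x (Ext \<Gamma> y \<mu> A) =
    (if y = x then Some (\<mu>, Emp) else map_option (\<lambda>(\<rho>, \<Gamma>'). (\<rho>, Ext \<Gamma>' y \<mu> A)) (locate x \<Gamma>))"
| "locate x (Lock \<Gamma> \<mu>) = map_option (\<lambda>(\<rho>, \<Gamma>'). (\<rho>, Lock \<Gamma>' \<mu>)) (locate x \<Gamma>)"

lemma locate_iff:
  "locate x \<Gamma> = Some (\<rho>, \<Gamma>') \<longleftrightarrow> (\<exists>\<Gamma>\<^sub>0 A. \<Gamma> = cat (Ext \<Gamma>\<^sub>0 x \<rho> A) \<Gamma>' \<and> x \<notin> vars \<Gamma>')"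
proof (induction \<Gamma> arbitrary: \<Gamma>')
  case Emp
  then show ?case by (cases \<Gamma>') auto
next
  case (Ext \<Gamma> y \<mu> B)
  then show ?case by (cases \<Gamma>') auto
next
  case (Lock \<Gamma> \<mu>)
  then show ?case by (cases \<Gamma>') auto
qed

text \<open>\<open>lockw \<M> \<Gamma> \<alpha> \<Delta> M\<close> is \<open>M{\<Gamma>, \<alpha>, \<Delta>}\<close>, with \<open>None\<close> for undefined. For \<open>\<alpha> : \<mu> \<Rightarrow> \<nu>\<close> with
  \<open>\<mu> : n \<rightarrow> m\<close>, the pre-context \<open>\<Delta>\<close> starts at mode \<open>n\<close>, and \<open>\<Gamma>'\<close> starts at the target of the tag
  \<open>\<rho>\<close>. A variable bound inside the term counts as declared in \<open>\<Delta>\<close>; as such a declaration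
  contributes nothing to \<open>|\<Delta>|\<close>, it need not be recorded for an index. The clauses for named binders,
  with \<open>\<Delta>\<close> extended by the bound variable (with any tag and type), are derived below.\<close>

primrec lockw :: "('o, 'm, 't) two_cat \<Rightarrow> 'm pctx \<Rightarrow> 't \<Rightarrow> 'm pctx \<Rightarrow> ('m, 't) trm \<Rightarrow> ('m, 't) trm option"
where
  "lockw \<M> \<Gamma> \<alpha> \<Delta> (FVar x \<alpha>') =
    (if x \<in> vars \<Delta> then Some (FVar x \<alpha>')
     else do {
       (\<rho>, \<Gamma>') \<leftarrow> locate x \<Gamma>;
       Some (FVar x (vcomp \<M>
         (hcomp \<M> (hcomp \<M> (id2 \<M> (locks \<M> (tgt \<M> \<rho>) \<Gamma>')) \<alpha>)
                  (id2 \<M> (locks \<M> (src \<M> (dom2 \<M> \<alpha>)) \<Delta>)))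
         \<alpha>'))
     })"
| "lockw \<M> \<Gamma> \<alpha> \<Delta> (BVar i \<alpha>') = Some (BVar i \<alpha>')"
| "lockw \<M> \<Gamma> \<alpha> \<Delta> (Tuple M N) =
    do { M' \<leftarrow> lockw \<M> \<Gamma> \<alpha> \<Delta> M; N' \<leftarrow> lockw \<M> \<Gamma> \<alpha> \<Delta> N; Some (Tuple M' N') }"
| "lockw \<M> \<Gamma> \<alpha> \<Delta> (Proj1 M) = do { M' \<leftarrow> lockw \<M> \<Gamma> \<alpha> \<Delta> M; Some (Proj1 M') }"
| "lockw \<M> \<Gamma> \<alpha> \<Delta> (Proj2 M) = do { M' \<leftarrow> lockw \<M> \<Gamma> \<alpha> \<Delta> M; Some (Proj2 M') }"
| "lockw \<M> \<Gamma> \<alpha> \<Delta> (Lam M) = do { M' \<leftarrow> lockw \<M> \<Gamma> \<alpha> \<Delta> M; Some (Lam M') }"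
| "lockw \<M> \<Gamma> \<alpha> \<Delta> (App \<xi> M N) =
    do { M' \<leftarrow> lockw \<M> \<Gamma> \<alpha> \<Delta> M; N' \<leftarrow> lockw \<M> \<Gamma> \<alpha> (Lock \<Delta> \<xi>) N; Some (App \<xi> M' N') }"
| "lockw \<M> \<Gamma> \<alpha> \<Delta> (In1 M) = do { M' \<leftarrow> lockw \<M> \<Gamma> \<alpha> \<Delta> M; Some (In1 M') }"
| "lockw \<M> \<Gamma> \<alpha> \<Delta> (In2 M) = do { M' \<leftarrow> lockw \<M> \<Gamma> \<alpha> \<Delta> M; Some (In2 M') }"
| "lockw \<M> \<Gamma> \<alpha> \<Delta> (Case M P Q) =
    do { M' \<leftarrow> lockw \<M> \<Gamma> \<alpha> \<Delta> M; P' \<leftarrow> lockw \<M> \<Gamma> \<alpha> \<Delta> P; Q' \<leftarrow> lockw \<M> \<Gamma> \<alpha> \<Delta> Q;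
         Some (Case M' P' Q') }"
| "lockw \<M> \<Gamma> \<alpha> \<Delta> (Mod \<xi> M) = do { M' \<leftarrow> lockw \<M> \<Gamma> \<alpha> (Lock \<Delta> \<xi>) M; Some (Mod \<xi> M') }"
| "lockw \<M> \<Gamma> \<alpha> \<Delta> (Let \<rho> \<xi> M N) =
    do { M' \<leftarrow> lockw \<M> \<Gamma> \<alpha> (Lock \<Delta> \<rho>) M; N' \<leftarrow> lockw \<M> \<Gamma> \<alpha> \<Delta> N; Some (Let \<rho> \<xi> M' N') }"

lemma lockw_vars_locks_cong:
  "\<lbrakk>vars \<Delta> = vars \<Delta>'; \<And>m. locks \<M> m \<Delta> = locks \<M> m \<Delta>'\<rbrakk>
    \<Longrightarrow> lockw \<M> \<Gamma> \<alpha> \<Delta> M = lockw \<M> \<Gamma> \<alpha> \<Delta>' M"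
proof (induction M arbitrary: \<Delta> \<Delta>')
  case (App \<xi> M N)
  from App.IH(1)[OF App.prems] App.IH(2)[of "Lock \<Delta> \<xi>" "Lock \<Delta>' \<xi>"] App.prems
  show ?case by simp
next
  case (Mod \<xi> M)
  from Mod.IH[of "Lock \<Delta> \<xi>" "Lock \<Delta>' \<xi>"] Mod.prems show ?case by simp
next
  case (Let \<rho> \<xi> M N)
  from Let.IH(1)[of "Lock \<Delta> \<rho>" "Lock \<Delta>' \<rho>"] Let.IH(2)[OF Let.prems] Let.prems
  show ?case by simp
next
  case (Tuple M N)
  from Tuple.IH(1)[OF Tuple.prems] Tuple.IH(2)[OF Tuple.prems] show ?case by simp
next
  case (Case M P Q)
  from Case.IH(1)[OF Case.prems] Case.IH(2)[OF Case.prems] Case.IH(3)[OF Case.prems]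
  show ?case by simp
next
  case (Proj1 M)
  from Proj1.IH[OF Proj1.prems] show ?case by simp
next
  case (Proj2 M)
  from Proj2.IH[OF Proj2.prems] show ?case by simp
next
  case (Lam M)
  from Lam.IH[OF Lam.prems] show ?case by simp
next
  case (In1 M)
  from In1.IH[OF In1.prems] show ?case by simp
next
  case (In2 M)
  from In2.IH[OF In2.prems] show ?case by simp
qed simp_all

lemma lockw_bind_var:
  "lockw \<M> \<Gamma> \<alpha> \<Delta> (bind_var k x M) = map_option (bind_var k x) (lockw \<M> \<Gamma> \<alpha> (Ext \<Delta> x \<xi> A) M)"
proof (induction M arbitrary: \<Delta> k)
  case (FVar y \<beta>)
  then show ?case by (auto split: option.splits bind_splits)
next
  case (App \<zeta> M N)
  have "lockw \<M> \<Gamma> \<alpha> (Ext (Lock \<Delta> \<zeta>) x \<xi> A) N = lockw \<M> \<Gamma> \<alpha> (Lock (Ext \<Delta> x \<xi> A) \<zeta>) N"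
    by (rule lockw_vars_locks_cong) auto
  with App show ?case by (auto split: bind_splits)
next
  case (Mod \<zeta> M)
  have "lockw \<M> \<Gamma> \<alpha> (Ext (Lock \<Delta> \<zeta>) x \<xi> A) M = lockw \<M> \<Gamma> \<alpha> (Lock (Ext \<Delta> x \<xi> A) \<zeta>) M"
    by (rule lockw_vars_locks_cong) auto
  with Mod show ?case by (auto split: bind_splits)
next
  case (Let \<rho> \<zeta> M N)
  have "lockw \<M> \<Gamma> \<alpha> (Ext (Lock \<Delta> \<rho>) x \<xi> A) M = lockw \<M> \<Gamma> \<alpha> (Lock (Ext \<Delta> x \<xi> A) \<rho>) M"
    by (rule lockw_vars_locks_cong) auto
  with Let show ?case by (auto split: bind_splits)
qed (auto split: bind_splits)

lemma lockw_lam: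
  "lockw \<M> \<Gamma> \<alpha> \<Delta> (lam x M) = map_option (lam x) (lockw \<M> \<Gamma> \<alpha> (Ext \<Delta> x \<xi> A) M)"
  by (auto simp add: lam_def lockw_bind_var[where \<xi> = \<xi> and A = A] split: bind_splits)

lemma lockw_case_of:
  "lockw \<M> \<Gamma> \<alpha> \<Delta> (case_of M x P y Q) =
    do { M' \<leftarrow> lockw \<M> \<Gamma> \<alpha> \<Delta> M;
         P' \<leftarrow> lockw \<M> \<Gamma> \<alpha> (Ext \<Delta> x (id1 \<M> m) A) P;
         Q' \<leftarrow> lockw \<M> \<Gamma> \<alpha> (Ext \<Delta> y (id1 \<M> m) B) Q;
         Some (case_of M' x P' y Q') }"
  by (auto simp add: case_of_def lockw_bind_var[where x = x and \<xi> = "id1 \<M> m" and A = A]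
      lockw_bind_var[where x = y and \<xi> = "id1 \<M> m" and A = B] split: bind_splits)

lemma lockw_let_mod:
  "lockw \<M> \<Gamma> \<alpha> \<Delta> (let_mod \<rho> \<xi> x M N) =
    do { M' \<leftarrow> lockw \<M> \<Gamma> \<alpha> (Lock \<Delta> \<rho>) M;
         N' \<leftarrow> lockw \<M> \<Gamma> \<alpha> (Ext \<Delta> x (comp1 \<M> \<rho> \<xi>) A) N;
         Some (let_mod \<rho> \<xi> x M' N') }"
  by (auto simp add: let_mod_def lockw_bind_var[where \<xi> = "comp1 \<M> \<rho> \<xi>" and A = A]
      split: bind_splits)

section \<open>Substitution\<close>

text \<open>\<open>tm_subst \<M> \<Gamma> M x N\<close> is \<open>N[M/x]\<^sub>\<Gamma>\<close>.\<close>

primrec tm_subst ::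
  "('o, 'm, 't) two_cat \<Rightarrow> 'm pctx \<Rightarrow> ('m, 't) trm \<Rightarrow> vname \<Rightarrow> ('m, 't) trm \<Rightarrow> ('m, 't) trm option"
where
  "tm_subst \<M> \<Gamma> M x (FVar y \<alpha>) = (if y = x then lockw \<M> \<Gamma> \<alpha> Emp M else Some (FVar y \<alpha>))"
| "tm_subst \<M> \<Gamma> M x (BVar i \<alpha>) = Some (BVar i \<alpha>)"
| "tm_subst \<M> \<Gamma> M x (Tuple N P) =
    do { N' \<leftarrow> tm_subst \<M> \<Gamma> M x N; P' \<leftarrow> tm_subst \<M> \<Gamma> M x P; Some (Tuple N' P') }"
| "tm_subst \<M> \<Gamma> M x (Proj1 N) = do { N' \<leftarrow> tm_subst \<M> \<Gamma> M x N; Some (Proj1 N') }"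
| "tm_subst \<M> \<Gamma> M x (Proj2 N) = do { N' \<leftarrow> tm_subst \<M> \<Gamma> M x N; Some (Proj2 N') }"
| "tm_subst \<M> \<Gamma> M x (Lam N) = do { N' \<leftarrow> tm_subst \<M> \<Gamma> M x N; Some (Lam N') }"
| "tm_subst \<M> \<Gamma> M x (App \<xi> N P) =
    do { N' \<leftarrow> tm_subst \<M> \<Gamma> M x N; P' \<leftarrow> tm_subst \<M> \<Gamma> M x P; Some (App \<xi> N' P') }"
| "tm_subst \<M> \<Gamma> M x (In1 N) = do { N' \<leftarrow> tm_subst \<M> \<Gamma> M x N; Some (In1 N') }"
| "tm_subst \<M> \<Gamma> M x (In2 N) = do { N' \<leftarrow> tm_subst \<M> \<Gamma> M x N; Some (In2 N') }"
| "tm_subst \<M> \<Gamma> M x (Case N P Q) =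
    do { N' \<leftarrow> tm_subst \<M> \<Gamma> M x N; P' \<leftarrow> tm_subst \<M> \<Gamma> M x P; Q' \<leftarrow> tm_subst \<M> \<Gamma> M x Q;
         Some (Case N' P' Q') }"
| "tm_subst \<M> \<Gamma> M x (Mod \<xi> N) = do { N' \<leftarrow> tm_subst \<M> \<Gamma> M x N; Some (Mod \<xi> N') }"
| "tm_subst \<M> \<Gamma> M x (Let \<rho> \<xi> N P) =
    do { N' \<leftarrow> tm_subst \<M> \<Gamma> M x N; P' \<leftarrow> tm_subst \<M> \<Gamma> M x P; Some (Let \<rho> \<xi> N' P') }"

lemma fv_lockw: "lockw \<M> \<Gamma> \<alpha> \<Delta> M = Some M' \<Longrightarrow> fv M' = fv M"
  by (induction M arbitrary: \<Delta> M') (auto split: if_splits bind_splits)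

lemma bind_var_fresh: "x \<notin> fv M \<Longrightarrow> bind_var k x M = M"
  by (induction M arbitrary: k) auto

lemma tm_subst_bind_var:
  assumes "y \<noteq> x" and "y \<notin> fv M"
  shows "tm_subst \<M> \<Gamma> M x (bind_var k y N) = map_option (bind_var k y) (tm_subst \<M> \<Gamma> M x N)"
  using assms
proof (induction N arbitrary: k)
  case (FVar z \<beta>)
  then show ?case
    by (cases "lockw \<M> \<Gamma> \<beta> Emp M") (auto simp: bind_var_fresh fv_lockw)
qed (auto split: bind_splits)

lemma tm_subst_lam:
  "\<lbrakk>y \<noteq> x; y \<notin> fv M\<rbrakk> \<Longrightarrow> tm_subst \<M> \<Gamma> M x (lam y N) = map_option (lam y) (tm_subst \<M> \<Gamma> M x N)"
  by (auto simp add: lam_def tm_subst_bind_var split: bind_splits)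

lemma tm_subst_case_of:
  "\<lbrakk>y \<noteq> x; y \<notin> fv M; z \<noteq> x; z \<notin> fv M\<rbrakk> \<Longrightarrow>
    tm_subst \<M> \<Gamma> M x (case_of N y P z Q) =
      do { N' \<leftarrow> tm_subst \<M> \<Gamma> M x N; P' \<leftarrow> tm_subst \<M> \<Gamma> M x P; Q' \<leftarrow> tm_subst \<M> \<Gamma> M x Q;
           Some (case_of N' y P' z Q') }"
  by (auto simp add: case_of_def tm_subst_bind_var split: bind_splits)

lemma tm_subst_let_mod:
  "\<lbrakk>y \<noteq> x; y \<notin> fv M\<rbrakk> \<Longrightarrow>
    tm_subst \<M> \<Gamma> M x (let_mod \<rho> \<xi> y N P) =
      do { N' \<leftarrow> tm_subst \<M> \<Gamma> M x N; P' \<leftarrow> tm_subst \<M> \<Gamma> M x P; Some (let_mod \<rho> \<xi> y N' P') }"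
  by (auto simp add: let_mod_def tm_subst_bind_var split: bind_splits)

end

theory Submission
  imports Defs
begin

text \<open>
  A context matters for typing only through the map sending each declared variable to its tag, its
  type and the composite of the locks to its right; this map is invariant under the identification
  of contexts. Typing relative to such maps, with a second list of entries for the bound indices,
  therefore needs neither a conversion rule nor freshness conditions. In that system, weakening,
  lock-weakening and substitution are plain inductions, and on contexts it coincides with the
  original one. At an occurrence \<open>x\<^sub>\<alpha>\<close> with \<open>\<alpha> : \<mu> \<Rightarrow> |\<Delta>|\<close>, lock-weakening moves \<open>M\<close> from
  \<open>\<Gamma>.lock\<^sub>\<mu>\<close> to \<open>\<Gamma>\<close> locked by \<open>|\<Delta>|\<close>, whose entries are among those of \<open>\<Gamma>,\<Delta>\<close>.
\<close>

section \<open>Variable environments\<close>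

text \<open>An entry holds the tag, the type and the composite of the locks standing to the right of
  the declaration. A further lock therefore composes on the right of the third component.\<close>

type_synonym 'm entry = "'m \<times> 'm ty \<times> 'm"

fun lock_entry :: "('o, 'm, 't) two_cat \<Rightarrow> 'm \<Rightarrow> 'm entry \<Rightarrow> 'm entry" where
  "lock_entry \<M> \<nu> (\<mu>, A, \<theta>) = (\<mu>, A, comp1 \<M> \<theta> \<nu>)"

definition lock_env ::
  "('o, 'm, 't) two_cat \<Rightarrow> 'm \<Rightarrow> (vname \<rightharpoonup> 'm entry) \<Rightarrow> (vname \<rightharpoonup> 'm entry)" where
  "lock_env \<M> \<nu> F = (\<lambda>x. map_option (lock_entry \<M> \<nu>) (F x))"

text \<open>A declaration with tag \<open>\<mu>\<close> sits in a context whose mode is the target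
  of \<open>\<mu>\<close>. The tag thus says which identity the lock composite starts from, and no
  mode has to be passed along.\<close>

primrec env :: "('o, 'm, 't) two_cat \<Rightarrow> 'm pctx \<Rightarrow> (vname \<rightharpoonup> 'm entry)" where
  "env \<M> Emp = Map.empty"
| "env \<M> (Ext \<Gamma> x \<mu> A) = (env \<M> \<Gamma>)(x \<mapsto> (\<mu>, A, id1 \<M> (tgt \<M> \<mu>)))"
| "env \<M> (Lock \<Gamma> \<mu>) = lock_env \<M> \<mu> (env \<M> \<Gamma>)"

lemma lock_env_upd:
  "lock_env \<M> \<nu> (F(x := v)) = (lock_env \<M> \<nu> F)(x := map_option (lock_entry \<M> \<nu>) v)"
  by (auto simp: lock_env_def)

lemma lock_env_mono: "F \<subseteq>\<^sub>m F' \<Longrightarrow> lock_env \<M> \<nu> F \<subseteq>\<^sub>m lock_env \<M> \<nu> F'"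
  by (force simp: lock_env_def map_le_def dom_def)

lemma lock_env_eq_Some: "F x = Some e \<Longrightarrow> lock_env \<M> \<nu> F x = Some (lock_entry \<M> \<nu> e)"
  by (simp add: lock_env_def)

lemma dom_env: "dom (env \<M> \<Gamma>) = vars \<Gamma>"
  by (induction \<Gamma>) (auto simp: lock_env_def dom_def)

lemma env_eq_None_iff: "env \<M> \<Gamma> x = None \<longleftrightarrow> x \<notin> vars \<Gamma>"
  using dom_env[of \<M> \<Gamma>] by blast

lemma vars_cat [simp]: "vars (cat \<Gamma> \<Delta>) = vars \<Gamma> \<union> vars \<Delta>"
  by (induction \<Delta>) auto

lemma finite_vars: "finite (vars \<Gamma>)"
  by (induction \<Gamma>) auto

lemma env_cat_declared:
  "x \<notin> vars \<Delta> \<Longrightarrow> env \<M> (cat (Ext \<Gamma> x \<mu> A) \<Delta>) x = Some (\<mu>, A, locks \<M> (tgt \<M> \<mu>) \<Delta>)"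
  by (induction \<Delta>) (auto simp: lock_env_def)

lemma env_cat_other: "y \<noteq> x \<Longrightarrow> env \<M> (cat (Ext \<Gamma> x \<mu> A) \<Delta>) y = env \<M> (cat \<Gamma> \<Delta>) y"
  by (induction \<Delta>) (auto simp: lock_env_def)

text \<open>Recovers from an entry the split of the context that \<open>t_var\<close> and
  \<open>locate\<close> ask for; converse to \<open>env_cat_declared\<close>.\<close>

lemma env_eq_SomeD:
  "env \<M> \<Gamma> x = Some (\<mu>, A, \<theta>) \<Longrightarrow>
    \<exists>\<Gamma>\<^sub>0 \<Delta>. \<Gamma> = cat (Ext \<Gamma>\<^sub>0 x \<mu> A) \<Delta> \<and> x \<notin> vars \<Delta> \<and> \<theta> = locks \<M> (tgt \<M> \<mu>) \<Delta>"
proof (induction \<Gamma> arbitrary: \<theta>)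
  case Emp
  then show ?case by simp
next
  case (Ext \<Gamma> y \<nu> B)
  show ?case
  proof (cases "y = x")
    case True
    with Ext.prems have "Ext \<Gamma> y \<nu> B = cat (Ext \<Gamma> x \<mu> A) Emp \<and> \<theta> = locks \<M> (tgt \<M> \<mu>) Emp"
      by auto
    then show ?thesis by (metis empty_iff vars.simps(1))
  next
    case False
    with Ext obtain \<Gamma>\<^sub>0 \<Delta> where "\<Gamma> = cat (Ext \<Gamma>\<^sub>0 x \<mu> A) \<Delta>" "x \<notin> vars \<Delta>"
      "\<theta> = locks \<M> (tgt \<M> \<mu>) \<Delta>"
      by fastforce
    with False show ?thesis by (intro exI[of _ \<Gamma>\<^sub>0] exI[of _ "Ext \<Delta> y \<nu> B"]) auto
  qed
next
  case (Lock \<Gamma> \<nu>)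
  then obtain \<theta>' where "env \<M> \<Gamma> x = Some (\<mu>, A, \<theta>')" "\<theta> = comp1 \<M> \<theta>' \<nu>"
    by (auto simp: lock_env_def)
  with Lock.IH obtain \<Gamma>\<^sub>0 \<Delta> where "\<Gamma> = cat (Ext \<Gamma>\<^sub>0 x \<mu> A) \<Delta>" "x \<notin> vars \<Delta>"
    "\<theta>' = locks \<M> (tgt \<M> \<mu>) \<Delta>"
    by blast
  with \<open>\<theta> = comp1 \<M> \<theta>' \<nu>\<close> show ?case by (intro exI[of _ \<Gamma>\<^sub>0] exI[of _ "Lock \<Delta> \<nu>"]) auto
qed

section \<open>Well-formed contexts and invariance under their identification\<close>

inductive_cases is_ctx_ExtE: "is_ctx \<M> (Ext \<Gamma> x \<mu> A) m"
inductive_cases is_ctx_LockE: "is_ctx \<M> (Lock \<Gamma> \<mu>) n"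

inductive_cases is_ty_PlusE: "is_ty \<M> (Plus A B) m"
inductive_cases is_ty_TimesE: "is_ty \<M> (Times A B) m"
inductive_cases is_ty_ArrE: "is_ty \<M> (Arr \<mu> A B) m"
inductive_cases is_ty_ModalE: "is_ty \<M> (Modal \<mu> A) m"

lemma modality_unique: "\<lbrakk>modality \<M> \<mu> n m; modality \<M> \<mu> n' m'\<rbrakk> \<Longrightarrow> n = n' \<and> m = m'"
  by (auto simp: modality_def)

lemma is_ctx_LockD: "\<lbrakk>is_ctx \<M> (Lock \<Gamma> \<mu>) k; modality \<M> \<mu> n m\<rbrakk> \<Longrightarrow> is_ctx \<M> \<Gamma> m"
  by (auto elim!: is_ctx_LockE dest: modality_unique)

lemma is_ctx_strengthen: "is_ctx \<M> (cat (Ext \<Gamma> x \<mu> A) \<Delta>) b \<Longrightarrow> is_ctx \<M> (cat \<Gamma> \<Delta>) b"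
  by (induction \<Delta> arbitrary: b) (auto elim!: is_ctx_ExtE is_ctx_LockE intro: is_ctx.intros)

lemma is_ctx_cat_fresh: "is_ctx \<M> (cat (Ext \<Gamma> x \<mu> A) \<Delta>) b \<Longrightarrow> x \<notin> vars \<Delta>"
  by (induction \<Delta> arbitrary: b) (auto elim!: is_ctx_ExtE is_ctx_LockE)

lemma is_ctx_prefix_fresh: "is_ctx \<M> (cat (Ext \<Gamma> x \<mu> A) \<Delta>) b \<Longrightarrow> x \<notin> vars \<Gamma>"
  by (induction \<Delta> arbitrary: b) (auto elim!: is_ctx_ExtE is_ctx_LockE)

context mode_theory
begin

text \<open>Each lock composite runs from the ambient mode to the target of the tag. This is the
  typing information under which the unit and associativity laws apply to entries.\<close>

lemma is_ctx_env:
  "\<lbrakk>is_ctx \<M> \<Gamma> m; env \<M> \<Gamma> x = Some (\<mu>, A, \<theta>)\<rbrakk> \<Longrightarrow>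
    modality \<M> \<theta> m (tgt \<M> \<mu>) \<and> modality \<M> \<mu> (src \<M> \<mu>) (tgt \<M> \<mu>) \<and> is_ty \<M> A (src \<M> \<mu>)"
proof (induction arbitrary: \<theta> rule: is_ctx.induct)
  case (ctx_Emp m)
  then show ?case by simp
next
  case (ctx_Ext \<Gamma> m B n \<nu> y)
  moreover from ctx_Ext have "modality \<M> (id1 \<M> m) m m" "tgt \<M> \<nu> = m" "src \<M> \<nu> = n"
    using modality_Ob id1_modality by (auto simp: modality_def)
  ultimately show ?case by (auto split: if_splits)
next
  case (ctx_Lock \<Gamma> m \<nu> n)
  then show ?case by (auto simp: lock_env_def intro: comp1_modality)
qed

lemma is_ctx_Ob: "is_ctx \<M> \<Gamma> m \<Longrightarrow> m \<in> Ob \<M>"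
  by (induction rule: is_ctx.induct) (auto dest: modality_Ob)

lemma lock_env_id:
  assumes "is_ctx \<M> \<Gamma> m"
  shows "lock_env \<M> (id1 \<M> m) (env \<M> \<Gamma>) = env \<M> \<Gamma>"
proof
  fix x
  show "lock_env \<M> (id1 \<M> m) (env \<M> \<Gamma>) x = env \<M> \<Gamma> x"
    using is_ctx_env[OF assms, of x] comp1_id_right
    by (cases "env \<M> \<Gamma> x") (auto simp: lock_env_def)
qed

lemma lock_env_comp:
  assumes "is_ctx \<M> \<Gamma> m" "modality \<M> \<mu> n m" "modality \<M> \<nu> k n"
  shows "lock_env \<M> \<nu> (lock_env \<M> \<mu> (env \<M> \<Gamma>)) = lock_env \<M> (comp1 \<M> \<mu> \<nu>) (env \<M> \<Gamma>)"
proof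
  fix x
  show "lock_env \<M> \<nu> (lock_env \<M> \<mu> (env \<M> \<Gamma>)) x = lock_env \<M> (comp1 \<M> \<mu> \<nu>) (env \<M> \<Gamma>) x"
    using is_ctx_env[OF assms(1), of x] comp1_assoc[OF _ assms(2,3)]
    by (cases "env \<M> \<Gamma> x") (auto simp: lock_env_def)
qed

lemma lock_locks:
  assumes "is_ctx \<M> \<Gamma> m" "modality \<M> \<mu> n m" "modality \<M> (locks \<M> n \<Delta>) k n" "modality \<M> \<xi> l k"
  shows "lock_env \<M> \<xi> (lock_env \<M> (locks \<M> n \<Delta>) (lock_env \<M> \<mu> (env \<M> \<Gamma>))) =
    lock_env \<M> (locks \<M> n (Lock \<Delta> \<xi>)) (lock_env \<M> \<mu> (env \<M> \<Gamma>))"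
  using lock_env_comp[OF ctx_Lock[OF assms(1,2)] assms(3,4)] by simp

text \<open>Only the two generating identifications carry content: they become the right unit law
  and associativity of 1-cells, through \<open>lock_env_id\<close> and
  \<open>lock_env_comp\<close>.\<close>

lemma ctx_eq_env:
  "ctx_eq \<M> m \<Gamma> \<Gamma>' \<Longrightarrow> is_ctx \<M> \<Gamma> m \<and> is_ctx \<M> \<Gamma>' m \<and> env \<M> \<Gamma> = env \<M> \<Gamma>'"
proof (induction rule: ctx_eq.induct)
  case (eq_Lock_id \<Gamma> m)
  then show ?case
    using lock_env_id is_ctx_Ob id1_modality by (auto intro: is_ctx.intros)
next
  case (eq_Lock_comp \<Gamma> m \<mu> n \<nu> k)
  then show ?case
    using lock_env_comp comp1_modality by (auto intro: is_ctx.intros)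
qed (auto intro: is_ctx.intros)

text \<open>The empty context is excluded because it lives at every mode, so that its mode need not match
  the one at which \<open>\<Delta>\<close> starts.\<close>

lemma modality_locks:
  "\<lbrakk>is_ctx \<M> \<Gamma> m; \<Gamma> \<noteq> Emp; is_ctx \<M> (cat \<Gamma> \<Delta>) k\<rbrakk> \<Longrightarrow> modality \<M> (locks \<M> m \<Delta>) k m"
proof (induction \<Delta> arbitrary: k)
  case Emp
  \<comment> \<open>A nonempty context has a unique mode: the target of its last tag or the source
    of its last lock.\<close>
  then have "m = k" by (cases \<Gamma>) (auto elim!: is_ctx_ExtE is_ctx_LockE dest: modality_unique)
  with Emp show ?case by (auto intro: id1_modality is_ctx_Ob)
qed (auto elim!: is_ctx_ExtE is_ctx_LockE intro: comp1_modality)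

text \<open>Forgetting the declarations of \<open>\<Delta>\<close> and keeping its locks only
  removes entries: by well-formedness its variables are fresh for \<open>\<Gamma>\<close>, so they
  overwrite nothing. The declaration of \<open>x\<close> makes the prefix nonempty, as
  \<open>modality_locks\<close> demands.\<close>

lemma lock_env_locks_le:
  assumes "is_ctx \<M> \<Gamma> m"
  shows "\<lbrakk>is_ctx \<M> (cat (Ext \<Gamma> x \<mu> A) \<Delta>) k; is_ctx \<M> (Ext \<Gamma> x \<mu> A) m\<rbrakk> \<Longrightarrow>
    lock_env \<M> (locks \<M> m \<Delta>) (env \<M> \<Gamma>) \<subseteq>\<^sub>m env \<M> (cat \<Gamma> \<Delta>)"
proof (induction \<Delta> arbitrary: k)
  case Emp
  then show ?case using lock_env_id[OF assms] by simp
next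
  case (Ext \<Delta> y \<nu> B)
  then have "y \<notin> vars (cat \<Gamma> \<Delta>)" by (auto elim!: is_ctx_ExtE)
  then have "env \<M> (cat \<Gamma> \<Delta>) y = None" by (simp only: env_eq_None_iff not_False_eq_True)
  moreover have "lock_env \<M> (locks \<M> m \<Delta>) (env \<M> \<Gamma>) \<subseteq>\<^sub>m env \<M> (cat \<Gamma> \<Delta>)"
    using Ext by (auto elim: is_ctx_ExtE)
  ultimately show ?case by (auto simp: map_le_def dom_def)
next
  case (Lock \<Delta> \<nu>)
  from Lock.prems(1) obtain l where l: "is_ctx \<M> (cat (Ext \<Gamma> x \<mu> A) \<Delta>) l" "modality \<M> \<nu> k l"
    by (auto elim: is_ctx_LockE)
  then have "modality \<M> (locks \<M> m \<Delta>) l m"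
    using modality_locks[OF Lock.prems(2)] by blast
  then show ?case
    using lock_env_mono[OF Lock.IH[OF l(1) Lock.prems(2)], of \<M> \<nu>] lock_env_comp[OF assms _ l(2)]
    by simp
qed

end

section \<open>Typing relative to environments\<close>

text \<open>The list gives the entries of the bound indices, innermost first; locks act on it as
  they do on the map. The type premises of \<open>h_lam\<close>, \<open>h_case\<close> and
  \<open>h_let\<close> replace the well-formedness of the extended context, which an environment
  does not record.\<close>

inductive has_ty ::
  "('o, 'm, 't) two_cat \<Rightarrow> (vname \<rightharpoonup> 'm entry) \<Rightarrow> 'm entry list \<Rightarrow> ('m, 't) trm \<Rightarrow> 'm ty \<Rightarrow> 'o \<Rightarrow> bool"
  for \<M> where
  h_fvar: "\<lbrakk>F x = Some (\<mu>, A, \<theta>); modality \<M> \<mu> n m; transf \<M> \<alpha> \<mu> \<theta>\<rbrakk>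
    \<Longrightarrow> has_ty \<M> F G (FVar x \<alpha>) A n"
| h_bvar: "\<lbrakk>i < length G; G ! i = (\<mu>, A, \<theta>); modality \<M> \<mu> n m; transf \<M> \<alpha> \<mu> \<theta>\<rbrakk>
    \<Longrightarrow> has_ty \<M> F G (BVar i \<alpha>) A n"
| h_pair: "\<lbrakk>has_ty \<M> F G M A m; has_ty \<M> F G N B m\<rbrakk> \<Longrightarrow> has_ty \<M> F G (Tuple M N) (Times A B) m"
| h_proj1: "has_ty \<M> F G P (Times A B) m \<Longrightarrow> has_ty \<M> F G (Proj1 P) A m"
| h_proj2: "has_ty \<M> F G P (Times A B) m \<Longrightarrow> has_ty \<M> F G (Proj2 P) B m"
| h_lam: "\<lbrakk>modality \<M> \<mu> n m; is_ty \<M> A n; has_ty \<M> F ((\<mu>, A, id1 \<M> m) # G) M B m\<rbrakk>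
    \<Longrightarrow> has_ty \<M> F G (Lam M) (Arr \<mu> A B) m"
| h_app: "\<lbrakk>modality \<M> \<mu> n m; has_ty \<M> F G M (Arr \<mu> A B) m;
      has_ty \<M> (lock_env \<M> \<mu> F) (map (lock_entry \<M> \<mu>) G) N A n\<rbrakk>
    \<Longrightarrow> has_ty \<M> F G (App \<mu> M N) B m"
| h_in1: "\<lbrakk>has_ty \<M> F G M A m; is_ty \<M> B m\<rbrakk> \<Longrightarrow> has_ty \<M> F G (In1 M) (Plus A B) m"
| h_in2: "\<lbrakk>has_ty \<M> F G M B m; is_ty \<M> A m\<rbrakk> \<Longrightarrow> has_ty \<M> F G (In2 M) (Plus A B) m"
| h_case: "\<lbrakk>has_ty \<M> F G M (Plus A B) m; is_ty \<M> A m; is_ty \<M> B m;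
      has_ty \<M> F ((id1 \<M> m, A, id1 \<M> m) # G) P C m; has_ty \<M> F ((id1 \<M> m, B, id1 \<M> m) # G) Q C m\<rbrakk>
    \<Longrightarrow> has_ty \<M> F G (Case M P Q) C m"
| h_mod: "\<lbrakk>modality \<M> \<mu> n m; has_ty \<M> (lock_env \<M> \<mu> F) (map (lock_entry \<M> \<mu>) G) M A n\<rbrakk>
    \<Longrightarrow> has_ty \<M> F G (Mod \<mu> M) (Modal \<mu> A) m"
| h_let: "\<lbrakk>modality \<M> \<nu> k n; modality \<M> \<mu> n m; is_ty \<M> A k;
      has_ty \<M> (lock_env \<M> \<mu> F) (map (lock_entry \<M> \<mu>) G) M (Modal \<nu> A) n;
      has_ty \<M> F ((comp1 \<M> \<mu> \<nu>, A, id1 \<M> m) # G) N B m\<rbrakk>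
    \<Longrightarrow> has_ty \<M> F G (Let \<mu> \<nu> M N) B m"

text \<open>New index entries go at the outer end, so existing indices keep their meaning. This lets
  a term typed with no bound indices be placed under binders without shifting.\<close>

lemma has_ty_weaken:
  "\<lbrakk>has_ty \<M> F G M A m; F \<subseteq>\<^sub>m F'\<rbrakk> \<Longrightarrow> has_ty \<M> F' (G @ H) M A m"
proof (induction arbitrary: F' H rule: has_ty.induct)
  case (h_fvar F x \<mu> A \<theta> n m \<alpha> G)
  then have "F' x = Some (\<mu>, A, \<theta>)" by (metis domI map_le_def)
  with h_fvar show ?case by (blast intro: has_ty.h_fvar)
next
  case (h_bvar i G \<mu> A \<theta> n m \<alpha> F)
  then show ?case by (auto intro!: has_ty.h_bvar simp: nth_append)
next
  case (h_app \<mu> n m F G M A B N)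
  from h_app.IH(1)[OF h_app.prems, of H]
    h_app.IH(2)[OF lock_env_mono[OF h_app.prems], of "map (lock_entry \<M> \<mu>) H"] h_app.hyps(1)
  show ?case by (auto intro: has_ty.h_app)
next
  case (h_case F G M A B m P C Q)
  from h_case.IH[OF h_case.prems, of H] h_case.hyps(2,3)
  show ?case by (auto intro: has_ty.h_case)
next
  case (h_mod \<mu> n m F G M A)
  from h_mod.IH[OF lock_env_mono[OF h_mod.prems], of "map (lock_entry \<M> \<mu>) H"] h_mod.hyps(1)
  show ?case by (auto intro: has_ty.h_mod)
next
  case (h_let \<nu> k n \<mu> m A F G M N B)
  from h_let.IH(1)[OF lock_env_mono[OF h_let.prems], of "map (lock_entry \<M> \<mu>) H"]
    h_let.IH(2)[OF h_let.prems, of H] h_let.hyps(1-3)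
  show ?case by (auto intro: has_ty.h_let)
qed (auto intro: has_ty.intros)

text \<open>The name becomes the outermost index. Afterwards it no longer occurs free, so its value
  \<open>v\<close> is arbitrary; choosing the value it had before the declaration restores the
  original environment.\<close>

lemma has_ty_bind_var:
  "\<lbrakk>has_ty \<M> F G M A m; F x = Some e\<rbrakk> \<Longrightarrow>
    has_ty \<M> (F(x := v)) (G @ [e]) (bind_var (length G) x M) A m"
proof (induction arbitrary: e v rule: has_ty.induct)
  case (h_fvar F y \<mu> A \<theta> n m \<alpha> G)
  then show ?case by (auto intro: has_ty.intros)
next
  case (h_bvar i G \<mu> A \<theta> n m \<alpha> F)
  then show ?case by (auto intro!: has_ty.h_bvar simp: nth_append)
next
  case (h_app \<mu> n m F G M A B N)
  from h_app.IH(1)[OF h_app.prems, of v]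
    h_app.IH(2)[of "lock_entry \<M> \<mu> e" "map_option (lock_entry \<M> \<mu>) v",
      OF lock_env_eq_Some[of F x, OF h_app.prems]] h_app.hyps(1)
  show ?case by (auto intro: has_ty.h_app simp: lock_env_upd simp del: fun_upd_apply)
next
  case (h_proj1 F G P A B m)
  from h_proj1.IH[OF h_proj1.prems, of v] show ?case by (auto intro: has_ty.h_proj1)
next
  case (h_proj2 F G P A B m)
  from h_proj2.IH[OF h_proj2.prems, of v] show ?case by (auto intro: has_ty.h_proj2)
next
  case (h_case F G M A B m P C Q)
  from h_case.IH[OF h_case.prems, of v] h_case.hyps(2,3)
  show ?case by (auto intro: has_ty.h_case)
next
  case (h_mod \<mu> n m F G M A)
  from h_mod.IH[of "lock_entry \<M> \<mu> e" "map_option (lock_entry \<M> \<mu>) v",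
      OF lock_env_eq_Some[of F x, OF h_mod.prems]] h_mod.hyps(1)
  show ?case by (auto intro: has_ty.h_mod simp: lock_env_upd simp del: fun_upd_apply)
next
  case (h_let \<nu> k n \<mu> m A F G M N B)
  from h_let.IH(1)[of "lock_entry \<M> \<mu> e" "map_option (lock_entry \<M> \<mu>) v",
      OF lock_env_eq_Some[of F x, OF h_let.prems]]
    h_let.IH(2)[OF h_let.prems, of v] h_let.hyps(1-3)
  show ?case by (auto intro: has_ty.h_let simp: lock_env_upd simp del: fun_upd_apply)
qed (auto intro: has_ty.intros)

text \<open>Opposite of \<open>bind_var\<close>, for returning to the named binders of
  \<open>typing\<close>. Other indices stay fixed, since only the outermost index is ever
  opened.\<close>

primrec open_var :: "nat \<Rightarrow> vname \<Rightarrow> ('m, 't) trm \<Rightarrow> ('m, 't) trm" where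
  "open_var k x (FVar y \<alpha>) = FVar y \<alpha>"
| "open_var k x (BVar i \<alpha>) = (if i = k then FVar x \<alpha> else BVar i \<alpha>)"
| "open_var k x (Tuple M N) = Tuple (open_var k x M) (open_var k x N)"
| "open_var k x (Proj1 M) = Proj1 (open_var k x M)"
| "open_var k x (Proj2 M) = Proj2 (open_var k x M)"
| "open_var k x (Lam M) = Lam (open_var (Suc k) x M)"
| "open_var k x (App \<mu> M N) = App \<mu> (open_var k x M) (open_var k x N)"
| "open_var k x (In1 M) = In1 (open_var k x M)"
| "open_var k x (In2 M) = In2 (open_var k x M)"
| "open_var k x (Case M P Q) = Case (open_var k x M) (open_var (Suc k) x P) (open_var (Suc k) x Q)"
| "open_var k x (Mod \<mu> M) = Mod \<mu> (open_var k x M)"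
| "open_var k x (Let \<rho> \<xi> M N) = Let \<rho> \<xi> (open_var k x M) (open_var (Suc k) x N)"

lemma size_open_var [simp]: "size (open_var k x M) = size M"
  by (induction M arbitrary: k) auto

lemma bind_open_var: "x \<notin> fv M \<Longrightarrow> bind_var k x (open_var k x M) = M"
  by (induction M arbitrary: k) auto

lemma finite_fv: "finite (fv M)"
  by (induction M) auto

text \<open>Freshness of \<open>x\<close> for the term ensures that overriding the entry of
  \<open>x\<close> affects no occurrence already present.\<close>

lemma has_ty_open_var:
  "\<lbrakk>has_ty \<M> F (G @ [e]) M A m; x \<notin> fv M\<rbrakk> \<Longrightarrow>
    has_ty \<M> (F(x \<mapsto> e)) G (open_var (length G) x M) A m"
proof (induction F "G @ [e]" M A m arbitrary: G e rule: has_ty.induct)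
  case (h_fvar F y \<mu> A \<theta> n m \<alpha>)
  then show ?case by (auto intro: has_ty.intros)
next
  case (h_bvar i \<mu> A \<theta> n m \<alpha> F)
  then show ?case by (auto intro: has_ty.intros simp: nth_append split: if_splits)
next
  case (h_lam \<mu> n m A F M B)
  from h_lam.hyps(4)[of "(\<mu>, A, id1 \<M> m) # G" e] h_lam show ?case by (auto intro: has_ty.h_lam)
next
  case (h_app \<mu> n m F M A B N)
  from h_app.hyps(3)[of G e] h_app.hyps(5)[of "map (lock_entry \<M> \<mu>) G" "lock_entry \<M> \<mu> e"]
    h_app.hyps(1) h_app.prems
  show ?case by (auto intro: has_ty.h_app simp: lock_env_upd)
next
  case (h_case F M A B m P C Q)
  from h_case.hyps(2)[of G e] h_case.hyps(6)[of "(id1 \<M> m, A, id1 \<M> m) # G" e]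
    h_case.hyps(8)[of "(id1 \<M> m, B, id1 \<M> m) # G" e] h_case.hyps(3,4) h_case.prems
  show ?case by (auto intro: has_ty.h_case)
next
  case (h_mod \<mu> n m F M A)
  from h_mod.hyps(3)[of "map (lock_entry \<M> \<mu>) G" "lock_entry \<M> \<mu> e"] h_mod.hyps(1) h_mod.prems
  show ?case by (auto intro: has_ty.h_mod simp: lock_env_upd)
next
  case (h_let \<nu> k n \<mu> m A F M N B)
  from h_let.hyps(5)[of "map (lock_entry \<M> \<mu>) G" "lock_entry \<M> \<mu> e"]
    h_let.hyps(7)[of "(comp1 \<M> \<mu> \<nu>, A, id1 \<M> m) # G" e] h_let.hyps(1-3) h_let.prems
  show ?case by (auto intro: has_ty.h_let simp: lock_env_upd)
qed (auto intro: has_ty.intros)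

section \<open>Equivalence of the two typing judgements\<close>

context mode_theory
begin

lemma typing_regular: "typing \<M> \<Gamma> M A m \<Longrightarrow> is_ctx \<M> \<Gamma> m \<and> is_ty \<M> A m"
proof (induction rule: typing.induct)
  case (t_var \<Gamma> x \<mu> A \<Delta> n m \<alpha>)
  have "env \<M> (cat (Ext \<Gamma> x \<mu> A) \<Delta>) x = Some (\<mu>, A, locks \<M> (tgt \<M> \<mu>) \<Delta>)"
    by (rule env_cat_declared[OF is_ctx_cat_fresh[OF t_var(1)]])
  with t_var is_ctx_env show ?case by (fastforce simp: modality_def)
next
  case (t_let \<nu> k n \<mu> m \<Gamma> M A x N B)
  then show ?case by (auto elim: is_ctx_ExtE)
next
  case (t_conv \<Gamma> M A m \<Gamma>')
  then show ?case using ctx_eq_env by blast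
qed (auto intro: is_ty.intros dest: is_ctx_LockD
    elim: is_ctx_ExtE is_ty_PlusE is_ty_TimesE is_ty_ArrE is_ty_ModalE)

lemma has_ty_bind_Ext:
  assumes "has_ty \<M> (env \<M> (Ext \<Gamma> x \<mu> A)) [] M B m" "modality \<M> \<mu> n m"
  shows "has_ty \<M> (env \<M> \<Gamma>) [(\<mu>, A, id1 \<M> m)] (bind_var 0 x M) B m"
  using has_ty_bind_var[OF assms(1), of x "(\<mu>, A, id1 \<M> m)" "env \<M> \<Gamma> x"] assms(2)
  by (simp add: modality_def)

text \<open>Conversion disappears because identified contexts have equal environments. Regularity
  supplies the type premises at binders, and binding the name turns its entry into an index
  entry.\<close>

lemma has_ty_if_typing: "typing \<M> \<Gamma> M A m \<Longrightarrow> has_ty \<M> (env \<M> \<Gamma>) [] M A m"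
proof (induction rule: typing.induct)
  case (t_var \<Gamma> x \<mu> A \<Delta> n m \<alpha>)
  have "env \<M> (cat (Ext \<Gamma> x \<mu> A) \<Delta>) x = Some (\<mu>, A, locks \<M> (tgt \<M> \<mu>) \<Delta>)"
    by (rule env_cat_declared[OF is_ctx_cat_fresh[OF t_var(1)]])
  moreover have "tgt \<M> \<mu> = m" using t_var by (simp add: modality_def)
  ultimately show ?case using t_var by (auto intro: h_fvar)
next
  case (t_lam \<Gamma> x \<mu> A M B m)
  then obtain n where "is_ty \<M> A n" "modality \<M> \<mu> n m"
    using typing_regular by (blast elim: is_ctx_ExtE)
  with t_lam show ?case unfolding lam_def by (blast intro: h_lam has_ty_bind_Ext)
next
  case (t_case \<Gamma> M A B m x P C y Q)
  then have "is_ty \<M> A m" "is_ty \<M> B m" "modality \<M> (id1 \<M> m) m m"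
    using typing_regular is_ctx_Ob id1_modality by (blast elim: is_ty_PlusE)+
  with t_case show ?case unfolding case_of_def by (blast intro: h_case has_ty_bind_Ext)
next
  case (t_let \<nu> k n \<mu> m \<Gamma> M A x N B)
  have "is_ty \<M> (Modal \<nu> A) n" using t_let typing_regular by blast
  then have "is_ty \<M> A k" using t_let(1) by (auto elim!: is_ty_ModalE dest: modality_unique)
  moreover have "has_ty \<M> (env \<M> \<Gamma>) [(comp1 \<M> \<mu> \<nu>, A, id1 \<M> m)] (bind_var 0 x N) B m"
    using t_let comp1_modality by (blast intro: has_ty_bind_Ext)
  ultimately show ?case using t_let unfolding let_mod_def by (auto intro: h_let)
next
  case (t_conv \<Gamma> M A m \<Gamma>')
  then show ?case using ctx_eq_env by metis
qed (auto intro: has_ty.intros)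

lemma has_ty_open_Ext:
  assumes "has_ty \<M> (env \<M> \<Gamma>) [(\<mu>, A, id1 \<M> m)] M B m" "modality \<M> \<mu> n m" "is_ty \<M> A n"
    and "is_ctx \<M> \<Gamma> m"
  obtains x where "has_ty \<M> (env \<M> (Ext \<Gamma> x \<mu> A)) [] (open_var 0 x M) B m"
    "is_ctx \<M> (Ext \<Gamma> x \<mu> A) m" "bind_var 0 x (open_var 0 x M) = M"
proof -
  obtain x where x: "x \<notin> vars \<Gamma> \<union> fv M"
    using ex_new_if_finite[of "vars \<Gamma> \<union> fv M"] finite_vars finite_fv by blast
  have "has_ty \<M> (env \<M> (Ext \<Gamma> x \<mu> A)) [] (open_var 0 x M) B m"
    using has_ty_open_var[of \<M> "env \<M> \<Gamma>" "[]" "(\<mu>, A, id1 \<M> m)" M B m x] assms(1,2) x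
    by (auto simp: modality_def)
  with x assms that[of x] bind_open_var show thesis by (auto intro: ctx_Ext)
qed

text \<open>The induction is on size: the opened body of a binder is not a subterm, but has the same
  size as the body.\<close>

lemma typing_if_has_ty:
  "\<lbrakk>has_ty \<M> (env \<M> \<Gamma>) [] M A m; is_ctx \<M> \<Gamma> m\<rbrakk> \<Longrightarrow> typing \<M> \<Gamma> M A m"
proof (induction "size M" arbitrary: \<Gamma> M A m rule: less_induct)
  case less
  note IH = less.hyps
  note ctx = less.prems(2)
  \<comment> \<open>Premises leave \<open>\<Gamma>\<close> either under a lock or under a binder;
    \<open>lock\<close> and \<open>ext\<close> package the induction hypothesis for these two
    cases.\<close>
  have lock: "typing \<M> (Lock \<Gamma> \<mu>) N B n"
    if "size N < size M" "has_ty \<M> (lock_env \<M> \<mu> (env \<M> \<Gamma>)) (map (lock_entry \<M> \<mu>) []) N B n"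
      "modality \<M> \<mu> n m" for \<mu> n N B
    using that IH[of N "Lock \<Gamma> \<mu>"] ctx by (auto intro: ctx_Lock)
  have ext: "\<exists>x N'. N = bind_var 0 x N' \<and> typing \<M> (Ext \<Gamma> x \<mu> B) N' C m"
    if "size N < size M" "has_ty \<M> (env \<M> \<Gamma>) [(\<mu>, B, id1 \<M> m)] N C m"
      "modality \<M> \<mu> n m" "is_ty \<M> B n" for \<mu> n N B C
  proof -
    note N = that
    obtain x where "has_ty \<M> (env \<M> (Ext \<Gamma> x \<mu> B)) [] (open_var 0 x N) C m"
      "is_ctx \<M> (Ext \<Gamma> x \<mu> B) m" "bind_var 0 x (open_var 0 x N) = N"
      by (rule has_ty_open_Ext[OF N(2-4) ctx])
    with IH[of "open_var 0 x N"] N(1) show ?thesis by (metis size_open_var)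
  qed
  from less.prems(1) show ?case
  proof cases
    case (h_fvar x \<mu> \<theta> k \<alpha>)
    then obtain \<Gamma>\<^sub>0 \<Delta> where "\<Gamma> = cat (Ext \<Gamma>\<^sub>0 x \<mu> A) \<Delta>" "\<theta> = locks \<M> (tgt \<M> \<mu>) \<Delta>"
      using env_eq_SomeD[OF h_fvar(2)] by blast
    with h_fvar ctx show ?thesis by (auto intro!: t_var simp: modality_def)
  next
    case (h_lam \<mu> n B N C)
    from ext[OF _ h_lam(5,3,4)] h_lam(1,2) show ?thesis by (auto simp flip: lam_def intro: t_lam)
  next
    case (h_case N B C P Q)
    have idm: "modality \<M> (id1 \<M> m) m m" using ctx is_ctx_Ob id1_modality by blast
    obtain x P' where "P = bind_var 0 x P'" "typing \<M> (Ext \<Gamma> x (id1 \<M> m) B) P' A m"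
      using ext[OF _ h_case(5) idm h_case(3)] h_case(1) by auto
    moreover obtain y Q' where "Q = bind_var 0 y Q'" "typing \<M> (Ext \<Gamma> y (id1 \<M> m) C) Q' A m"
      using ext[OF _ h_case(6) idm h_case(4)] h_case(1) by auto
    moreover have "typing \<M> \<Gamma> N (Plus B C) m" using IH[of N] h_case(1,2) ctx by auto
    ultimately show ?thesis using h_case(1) by (auto simp flip: case_of_def intro: t_case)
  next
    case (h_let \<nu> k n \<mu> B P Q)
    obtain x Q' where "Q = bind_var 0 x Q'" "typing \<M> (Ext \<Gamma> x (comp1 \<M> \<mu> \<nu>) B) Q' A m"
      using ext[OF _ h_let(6) comp1_modality[OF h_let(3,2)] h_let(4)] h_let(1) by auto
    moreover have "typing \<M> (Lock \<Gamma> \<mu>) P (Modal \<nu> B) n" using lock[OF _ h_let(5,3)] h_let(1) by auto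
    ultimately show ?thesis using h_let by (auto simp flip: let_mod_def intro: t_let)
  next
    case (h_app \<mu> n P B Q)
    have "typing \<M> (Lock \<Gamma> \<mu>) Q B n" using lock[OF _ h_app(4,2)] h_app(1) by auto
    moreover have "typing \<M> \<Gamma> P (Arr \<mu> B A) m" using IH[of P] h_app(1,3) ctx by auto
    ultimately show ?thesis using h_app by (auto intro: t_app)
  next
    case (h_proj1 P B)
    with IH[of P] ctx show ?thesis by (auto intro: t_proj1)
  next
    case (h_proj2 P B)
    with IH[of P] ctx show ?thesis by (auto intro: t_proj2)
  next
    case (h_mod \<mu> n P B)
    have "typing \<M> (Lock \<Gamma> \<mu>) P B n" using lock[OF _ h_mod(4,3)] h_mod(1) by auto
    then show ?thesis using h_mod by (auto intro: t_mod)
  qed (use IH ctx in \<open>auto intro: typing.intros\<close>)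
qed

section \<open>Lock-weakening and substitution\<close>

text \<open>It suffices to consider \<open>\<Delta>\<close> without declarations: starting from the empty \<open>\<Delta>\<close>, the recursion
  only adds locks, since bound variables are indices.\<close>

lemma has_ty_lockw:
  assumes ctx: "is_ctx \<M> \<Gamma> m" and \<mu>: "modality \<M> \<mu> n m" and \<nu>: "modality \<M> \<nu> n m"
    and \<alpha>: "transf \<M> \<alpha> \<mu> \<nu>"
  shows "\<lbrakk>has_ty \<M> (lock_env \<M> (locks \<M> n \<Delta>) (lock_env \<M> \<mu> (env \<M> \<Gamma>))) G M B k;
      vars \<Delta> = {}; modality \<M> (locks \<M> n \<Delta>) k n\<rbrakk>
    \<Longrightarrow> \<exists>M'. lockw \<M> \<Gamma> \<alpha> \<Delta> M = Some M' \<and>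
      has_ty \<M> (lock_env \<M> (locks \<M> n \<Delta>) (lock_env \<M> \<nu> (env \<M> \<Gamma>))) G M' B k"
proof (induction "lock_env \<M> (locks \<M> n \<Delta>) (lock_env \<M> \<mu> (env \<M> \<Gamma>))" G M B k
    arbitrary: \<Delta> rule: has_ty.induct)
  case (h_fvar x \<rho> A \<theta> k l \<alpha>' G)
  then obtain \<theta>\<^sub>0 where \<theta>\<^sub>0: "env \<M> \<Gamma> x = Some (\<rho>, A, \<theta>\<^sub>0)"
    and \<theta>: "\<theta> = comp1 \<M> (comp1 \<M> \<theta>\<^sub>0 \<mu>) (locks \<M> n \<Delta>)"
    by (auto simp: lock_env_def)
  \<comment> \<open>The split found has \<open>x\<close> undeclared in its right part, so it is the
    one \<open>locate\<close> returns; hence \<open>lockw\<close> is defined here.\<close>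
  from env_eq_SomeD[OF \<theta>\<^sub>0] obtain \<Gamma>' where loc: "locate x \<Gamma> = Some (\<rho>, \<Gamma>')"
    and \<Gamma>': "\<theta>\<^sub>0 = locks \<M> (tgt \<M> \<rho>) \<Gamma>'"
    by (metis locate_iff)
  have m\<theta>: "modality \<M> \<theta>\<^sub>0 m (tgt \<M> \<rho>)" using is_ctx_env[OF ctx \<theta>\<^sub>0] by blast
  \<comment> \<open>The new annotation is built in stages: whisker \<alpha> on the left by the locks
    of \<Gamma> after \<open>x\<close>, then on the right by those of \<Delta>, and precompose with
    the old annotation.\<close>
  have "transf \<M> (hcomp \<M> (id2 \<M> \<theta>\<^sub>0) \<alpha>) (comp1 \<M> \<theta>\<^sub>0 \<mu>) (comp1 \<M> \<theta>\<^sub>0 \<nu>)"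
    by (rule hcomp_transf[OF id2_transf[OF m\<theta>] \<alpha> m\<theta> \<mu>])
  from hcomp_transf[OF this id2_transf[OF h_fvar.prems(2)] comp1_modality[OF m\<theta> \<mu>] h_fvar.prems(2)]
  have "transf \<M> (vcomp \<M> (hcomp \<M> (hcomp \<M> (id2 \<M> \<theta>\<^sub>0) \<alpha>) (id2 \<M> (locks \<M> n \<Delta>))) \<alpha>')
      \<rho> (comp1 \<M> (comp1 \<M> \<theta>\<^sub>0 \<nu>) (locks \<M> n \<Delta>))"
    using h_fvar(3) \<theta> by (blast intro: vcomp_transf)
  moreover have "src \<M> (dom2 \<M> \<alpha>) = n" using \<alpha> \<mu> by (auto simp: transf_def modality_def)
  moreover have "lock_env \<M> (locks \<M> n \<Delta>) (lock_env \<M> \<nu> (env \<M> \<Gamma>)) x =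
      Some (\<rho>, A, comp1 \<M> (comp1 \<M> \<theta>\<^sub>0 \<nu>) (locks \<M> n \<Delta>))"
    using \<theta>\<^sub>0 by (simp add: lock_env_def)
  ultimately show ?case using h_fvar loc \<Gamma>' by (auto intro: has_ty.h_fvar)
next
  case (h_app \<xi> l k G M A B N)
  \<comment> \<open>Passing under a lock appends it to \<Delta>; this equation, for the source and
    the target of \<alpha>, brings both environments into the form of the induction
    hypothesis.\<close>
  note lk = lock_locks[OF ctx _ h_app.prems(2) h_app.hyps(1)]
  from h_app.hyps(3)[OF refl h_app.prems] h_app.hyps(5)[of "Lock \<Delta> \<xi>"] h_app.hyps(1) h_app.prems
    lk[OF \<mu>] lk[OF \<nu>] comp1_modality[OF h_app.prems(2) h_app.hyps(1)]
  show ?case by (auto intro!: has_ty.h_app)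
next
  case (h_mod \<xi> l k G M A)
  note lk = lock_locks[OF ctx _ h_mod.prems(2) h_mod.hyps(1)]
  from h_mod.hyps(3)[of "Lock \<Delta> \<xi>"] h_mod.hyps(1) h_mod.prems
    lk[OF \<mu>] lk[OF \<nu>] comp1_modality[OF h_mod.prems(2) h_mod.hyps(1)]
  show ?case by (auto intro!: has_ty.h_mod)
next
  case (h_let \<zeta> j l \<xi> k A G M N B)
  note lk = lock_locks[OF ctx _ h_let.prems(2) h_let.hyps(2)]
  from h_let.hyps(5)[of "Lock \<Delta> \<xi>"] h_let.hyps(7)[OF refl h_let.prems] h_let.hyps(1-3) h_let.prems
    lk[OF \<mu>] lk[OF \<nu>] comp1_modality[OF h_let.prems(2) h_let.hyps(2)]
  show ?case by (auto intro!: has_ty.h_let)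
qed (fastforce intro: has_ty.intros)+

text \<open>Locks met in \<open>N\<close> are absorbed into \<open>\<Delta>\<close> and binders into
  \<open>G\<close>, so \<open>\<Gamma>\<close> stays fixed and the only real case is an occurrence
  of \<open>x\<close>.\<close>

lemma has_ty_tm_subst:
  assumes \<mu>: "modality \<M> \<mu> n m" and ctx: "is_ctx \<M> (Ext \<Gamma> x \<mu> A) m"
    and M: "has_ty \<M> (env \<M> (Lock \<Gamma> \<mu>)) [] M A n"
  shows "\<lbrakk>has_ty \<M> (env \<M> (cat (Ext \<Gamma> x \<mu> A) \<Delta>)) G N B b; is_ctx \<M> (cat (Ext \<Gamma> x \<mu> A) \<Delta>) b\<rbrakk>
    \<Longrightarrow> \<exists>N'. tm_subst \<M> \<Gamma> M x N = Some N' \<and> has_ty \<M> (env \<M> (cat \<Gamma> \<Delta>)) G N' B b"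
proof (induction "env \<M> (cat (Ext \<Gamma> x \<mu> A) \<Delta>)" G N B b arbitrary: \<Delta> rule: has_ty.induct)
  case (h_fvar y \<rho> B \<theta> b l \<alpha> G)
  show ?case
  proof (cases "y = x")
    case False
    with h_fvar show ?thesis by (auto simp: env_cat_other intro: has_ty.h_fvar)
  next
    case True
    have \<Gamma>: "is_ctx \<M> \<Gamma> m" using ctx by (auto elim: is_ctx_ExtE)
    have "env \<M> (cat (Ext \<Gamma> x \<mu> A) \<Delta>) x = Some (\<mu>, A, locks \<M> m \<Delta>)"
      using env_cat_declared[OF is_ctx_cat_fresh[OF h_fvar.prems]] \<mu> by (auto simp: modality_def)
    \<comment> \<open>The entry of \<open>x\<close> is unique, so the annotation is a 2-cell from
      \<mu> to the locks of \<Delta>, and the occurrence has the mode of \<open>M\<close>.\<close>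
    with h_fvar True \<mu> have eqs: "\<rho> = \<mu>" "B = A" "\<theta> = locks \<M> m \<Delta>" "b = n"
      by (auto dest: modality_unique)
    have \<alpha>: "transf \<M> \<alpha> \<mu> (locks \<M> m \<Delta>)" using h_fvar eqs by simp
    have \<nu>: "modality \<M> (locks \<M> m \<Delta>) n m"
      using modality_locks[OF ctx _ h_fvar.prems] eqs by simp
    have idn: "modality \<M> (id1 \<M> n) n n" using \<mu> modality_Ob id1_modality by blast
    \<comment> \<open>Lock-weakening starts from the empty pre-context, whose lock composite is an
      identity; this removes it on both sides.\<close>
    have lid: "lock_env \<M> (id1 \<M> n) (env \<M> (Lock \<Gamma> \<xi>)) = env \<M> (Lock \<Gamma> \<xi>)"
      if "modality \<M> \<xi> n m" for \<xi>
      using lock_env_id[OF ctx_Lock[OF \<Gamma> that]] .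
    obtain M' where M': "lockw \<M> \<Gamma> \<alpha> Emp M = Some M'"
      "has_ty \<M> (lock_env \<M> (locks \<M> m \<Delta>) (env \<M> \<Gamma>)) [] M' A n"
      using has_ty_lockw[OF \<Gamma> \<mu> \<nu> \<alpha>, of Emp "[]" M A n] M lid[OF \<mu>] lid[OF \<nu>] idn by auto
    \<comment> \<open>Weakening restores the declarations of \<Delta> and the bound indices in scope
      at the occurrence.\<close>
    from has_ty_weaken[OF M'(2) lock_env_locks_le[OF \<Gamma> h_fvar.prems ctx], of G] M'(1) True eqs
    show ?thesis by simp
  qed
next
  case (h_app \<xi> l k G M A B N)
  from h_app.hyps(3)[OF refl h_app.prems] h_app.hyps(5)[of "Lock \<Delta> \<xi>"] h_app.hyps(1)
    ctx_Lock[OF h_app.prems h_app.hyps(1)]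
  show ?case by (auto intro!: has_ty.h_app)
next
  case (h_mod \<xi> l k G M A)
  from h_mod.hyps(3)[of "Lock \<Delta> \<xi>"] h_mod.hyps(1) ctx_Lock[OF h_mod.prems h_mod.hyps(1)]
  show ?case by (auto intro!: has_ty.h_mod)
next
  case (h_let \<zeta> j l \<xi> k A G M N B)
  from h_let.hyps(5)[of "Lock \<Delta> \<xi>"] h_let.hyps(7)[OF refl h_let.prems] h_let.hyps(1-3)
    ctx_Lock[OF h_let.prems h_let.hyps(2)]
  show ?case by (auto intro!: has_ty.h_let)
qed (fastforce intro: has_ty.intros)+

end

theorem theorem6:
  fixes \<M> :: "('o, 'm, 't) two_cat"
    and \<mu> :: 'm and n m b :: 'o
    and \<Gamma> \<Delta> :: "'m pctx" and x :: vname
    and M N :: "('m, 't) trm" and A B :: "'m ty"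
  assumes "mode_theory \<M>"
    and "modality \<M> \<mu> n m"
    and "is_ctx \<M> \<Gamma> m"
    and "b \<in> Ob \<M>"
    and "typing \<M> (Lock \<Gamma> \<mu>) M A n"
    and "typing \<M> (cat (Ext \<Gamma> x \<mu> A) \<Delta>) N B b"
  shows "\<exists>N'. tm_subst \<M> \<Gamma> M x N = Some N' \<and> typing \<M> (cat \<Gamma> \<Delta>) N' B b"
proof -
  interpret mode_theory \<M> by fact
  have ctx: "is_ctx \<M> (cat (Ext \<Gamma> x \<mu> A) \<Delta>) b" using typing_regular assms(6) by blast
  \<comment> \<open>Freshness of \<open>x\<close> comes from the context of \<open>N\<close>, while
    the mode of \<open>A\<close> comes from regularity of the typing of \<open>M\<close>.\<close>
  have "x \<notin> vars \<Gamma>" using is_ctx_prefix_fresh[OF ctx] .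
  then have "is_ctx \<M> (Ext \<Gamma> x \<mu> A) m"
    using assms(2,3,5) typing_regular by (blast intro: ctx_Ext)
  from has_ty_tm_subst[OF assms(2) this has_ty_if_typing[OF assms(5)] has_ty_if_typing[OF assms(6)] ctx]
  show ?thesis using typing_if_has_ty is_ctx_strengthen[OF ctx] by blast
qed

end
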